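(* Let $h_{i,j}[k]\in\mathbb{C}$, $i,j,k\in\{1,2\}$, be channel coefficients (which may or may not depend on $k$), let $\theta=\tfrac12\tan^{-1}(2)$, $c=\cos\theta$, $s=\sin\theta$, $\varphi=e^{\sqrt{-1}\,\pi/4}$, and let $$\mathbf{H}=\begin{bmatrix} h_{1,1}[1] & 0 & \varphi h_{2,1}[1] & 0\\ 0 & h_{2,1}[2] & 0 & \varphi h_{1,1}[2]\\ h_{1,2}[1] & 0 & \varphi h_{2,2}[1] & 0\\ 0 & h_{2,2}[2] & 0 & \varphi h_{1,2}[2]\end{bmatrix}\begin{bmatrix} c & s & 0 & 0\\ -s & c & 0 & 0\\ 0 & 0 & c & s\\ 0 & 0 & -s & c\end{bmatrix}.$$ Then the matrix $\mathbf{R}$ in a QR decomposition $\mathbf{H}=\mathbf{Q}\mathbf{R}$, which results from an application of the Gram-Schmidt procedure to the columns of $\mathbf{H}$, with $\mathbf{Q}$ unitary and $\mathbf{R}$ upper triangular with nonnegative real diagonal elements, has the form $$\mathbf{R}=\begin{bmatrix}\mathbf{A} & \mathbf{B}\\ \mathbf{O} & \mathbf{D}\end{bmatrix}$$ with $2\times 2$ blocks, where $\mathbf{O}$ is the zero matrix and both of the upper triangular matrices $\mathbf{A}$ and $\mathbf{D}$ are entirely real.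
   Context: The matrix $\mathbf{H}$ is the effective channel matrix of the (Dayal-Varanasi) golden code with two transmit and two receive antennas; $h_{i,j}[k]$ is the channel coefficient from transmit antenna $i$ to receive antenna $j$ at time $k$. The channel may be quasistatic ($h_{i,j}[k]$ independent of $k$) or time-varying. Writing $\mathbf{h}_1,\dots,\mathbf{h}_4$ for the columns of $\mathbf{H}$ and $\mathbf{q}_1,\dots,\mathbf{q}_4$ for the columns of $\mathbf{Q}$, the entry of $\mathbf{R}$ in row $i$ and column $j$ is $r_{i,j}=\mathbf{q}_i^*\mathbf{h}_j$, where $^*$ denotes the conjugate transpose. *)

theory Defs
  imports
    "HOL-Analysis.Analysis"
    "Jordan_Normal_Form.Gram_Schmidt"
    "Jordan_Normal_Form.Schur_Decomposition"
begin

definition is_qr_decomposition :: "nat \<Rightarrow> complex mat \<Rightarrow> complex mat \<Rightarrow> complex mat \<Rightarrow> bool" where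
  "is_qr_decomposition n H Q R \<longleftrightarrow>
     H \<in> carrier_mat n n \<and> Q \<in> carrier_mat n n \<and> R \<in> carrier_mat n n \<and>
     mat_adjoint Q * Q = 1\<^sub>m n \<and>
     upper_triangular R \<and>
     (\<forall>i<n. R $$ (i, i) \<in> \<real> \<and> 0 \<le> Re (R $$ (i, i))) \<and>
     H = Q * R"

text \<open>
  The library's \<^const>\<open>gram_schmidt\<close> returns the unnormalized orthogonal vectors
  \<open>u\<^sub>j = h\<^sub>j - (\<Sum>i<j. (h\<^sub>j \<bullet>c u\<^sub>i) / (u\<^sub>i \<bullet>c u\<^sub>i) \<cdot> u\<^sub>i)\<close>, and since \<open>x / 0 = 0\<close> it
  just skips the terms with \<open>u\<^sub>i = 0\<close>. A step with \<open>u\<^sub>j \<noteq> 0\<close> determines column \<open>j\<close> of \<open>Q\<close>.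
  A step with \<open>u\<^sub>j = 0\<close> (column \<open>j\<close> of \<open>H\<close> depends linearly on the preceding ones) yields no
  direction; as usual, these columns of \<open>Q\<close> are filled in, after the procedure has run, by
  completing the vectors obtained to an orthonormal basis, so they are orthogonal to the whole
  column space of \<open>H\<close>. If \<open>H\<close> is invertible, no such step occurs.
\<close>

definition is_gram_schmidt_qr :: "nat \<Rightarrow> complex mat \<Rightarrow> complex mat \<Rightarrow> complex mat \<Rightarrow> bool" where
  "is_gram_schmidt_qr n H Q R \<longleftrightarrow>
     is_qr_decomposition n H Q R \<and>
     (\<forall>j<n. let u = gram_schmidt n (cols H) ! j in
        if u \<noteq> 0\<^sub>v n
        then col Q j = complex_of_real (1 / sqrt (Re (u \<bullet>c u))) \<cdot>\<^sub>v u
        else (\<forall>k<n. col H k \<bullet>c col Q j = 0))"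

end

theory Submission
  imports Defs
begin

text \<open>
  Let \<open>a\<close>, \<open>b\<close>, \<open>p\<close>, \<open>q\<close> be the columns of the unrotated channel matrix, so that the columns of \<open>H\<close>
  are \<open>c a - s b\<close>, \<open>s a + c b\<close>, \<open>c p - s q\<close>, \<open>s p + c q\<close>. The supports of \<open>a\<close>, \<open>p\<close> are disjoint
  from those of \<open>b\<close>, \<open>q\<close>. Hence the inner products \<open>c s (|a|\<^sup>2 - |b|\<^sup>2)\<close> and \<open>c s (|p|\<^sup>2 - |q|\<^sup>2)\<close>
  of the columns within each pair are real, which gives the entry in row 1, column 2. The projections
  of \<open>p\<close> and \<open>q\<close> to the span of \<open>a\<close> and \<open>b\<close> are multiples of \<open>a\<close> and \<open>b\<close>, hence still orthogonal.
  So the inner product of the projected columns 3 and 4 is again \<open>c s\<close> times a difference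
  of squared norms, and the entry in row 3, column 4 is real as well. The argument is carried out on
  the Gram matrix \<open>H\<^sup>* H = R\<^sup>* R\<close>; the Gram-Schmidt convention enters only in the rank-deficient
  case, where it makes every row of \<open>R\<close> with a zero diagonal entry vanish.
\<close>

section \<open>Inner products with the output of \<open>gram_schmidt\<close>\<close>

lemma gram_schmidt_sub2_nth:
  assumes "j < length ws"
  shows "gram_schmidt_sub2 n us ws ! j =
    adjuster n (ws ! j) (rev (take j (gram_schmidt_sub2 n us ws)) @ us) + ws ! j"
  using assms
proof (induction n us ws arbitrary: j rule: gram_schmidt_sub2.induct)
  case (1 n us)
  then show ?case by simp
next
  case (2 n us w ws)
  then show ?case by (cases j) (auto simp: Let_def)
qed

lemma length_gram_schmidt_sub2 [simp]: "length (gram_schmidt_sub2 n us ws) = length ws"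
  by (induction n us ws rule: gram_schmidt_sub2.induct) (auto simp: Let_def)

lemma adjuster_carrier_vec:
  "set us \<subseteq> carrier_vec n \<Longrightarrow> adjuster n w us \<in> carrier_vec n"
  by (induction us) auto

lemma gram_schmidt_sub2_carrier:
  assumes "set us \<subseteq> carrier_vec n" "set ws \<subseteq> carrier_vec n"
  shows "set (gram_schmidt_sub2 n us ws) \<subseteq> carrier_vec n"
  using assms
  by (induction n us ws rule: gram_schmidt_sub2.induct) (auto simp: Let_def adjuster_carrier_vec)

lemma adjuster_cscalar_prod_zero:
  fixes x :: "'a :: conjugatable_field vec"
  assumes "x \<in> carrier_vec n" "set us \<subseteq> carrier_vec n" "\<And>u. u \<in> set us \<Longrightarrow> u \<bullet>c x = 0"
  shows "adjuster n w us \<bullet>c x = 0"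
  using assms(2,3)
proof (induction us)
  case Nil
  then show ?case using assms(1) by simp
next
  case (Cons u us)
  have "adjuster n w (u # us) \<bullet>c x =
      (-(w \<bullet>c u) / (u \<bullet>c u) \<cdot>\<^sub>v u) \<bullet>c x + adjuster n w us \<bullet>c x"
    using Cons.prems assms(1) by (auto simp: add_scalar_prod_distrib[of _ n] adjuster_carrier_vec)
  also have "(-(w \<bullet>c u) / (u \<bullet>c u) \<cdot>\<^sub>v u) \<bullet>c x = -(w \<bullet>c u) / (u \<bullet>c u) * (u \<bullet>c x)"
    using Cons.prems assms(1) by (intro scalar_prod_smult_left) auto
  finally show ?case using Cons by auto
qed

text \<open>Output and input at position \<open>j\<close> differ by a combination of the earlier
  outputs, and \<open>x\<close> is orthogonal to all of these. Below, \<open>x\<close> is a column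
  of \<open>Q\<close>.\<close>

lemma gram_schmidt_nth_cscalar_prod:
  fixes x :: "'a :: conjugatable_field vec"
  assumes "set ws \<subseteq> carrier_vec n" "x \<in> carrier_vec n" "j < length ws"
    and orth: "\<And>i. i < j \<Longrightarrow> gram_schmidt n ws ! i \<bullet>c x = 0"
  shows "gram_schmidt n ws ! j \<bullet>c x = ws ! j \<bullet>c x"
proof -
  \<comment> \<open>Reversed because the recursion pushes each new vector onto the front of its
    accumulator.\<close>
  let ?us = "rev (take j (gram_schmidt n ws))"
  have us: "set ?us \<subseteq> carrier_vec n"
    using gram_schmidt_sub2_carrier[of "[]" n ws] assms(1) by (auto simp: gram_schmidt_code dest: in_set_takeD)
  have "adjuster n (ws ! j) ?us \<bullet>c x = 0"
    using us assms(2) orth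
    by (intro adjuster_cscalar_prod_zero) (auto simp: in_set_conv_nth)
  moreover have "gram_schmidt n ws ! j = adjuster n (ws ! j) ?us + ws ! j"
    using gram_schmidt_sub2_nth[OF assms(3), of n "[]"] by (simp add: gram_schmidt_code)
  moreover have "ws ! j \<in> carrier_vec n" using assms by auto
  ultimately show ?thesis
    using us assms(2) by (auto simp: add_scalar_prod_distrib[of _ n] adjuster_carrier_vec)
qed

section \<open>Adjoint products and QR decompositions\<close>

lemma mat_adjoint_index:
  "i < dim_col A \<Longrightarrow> j < dim_row A \<Longrightarrow> mat_adjoint A $$ (i, j) = conjugate (A $$ (j, i))"
  by (simp add: mat_adjoint_def mat_of_rows_index)

lemma mat_adjoint_carrier: "A \<in> carrier_mat n m \<Longrightarrow> mat_adjoint A \<in> carrier_mat m n"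
  by (auto simp: mat_adjoint_def)

lemma mat_adjoint_times_index:
  assumes "A \<in> carrier_mat n m" "B \<in> carrier_mat n k" "i < m" "j < k"
  shows "(mat_adjoint A * B) $$ (i, j) = col B j \<bullet>c col A i"
proof -
  have "(mat_adjoint A * B) $$ (i, j) = conjugate (col A i) \<bullet> col B j"
    using assms mat_adjoint_carrier[OF assms(1)]
    by (simp add: mat_adjoint_def)
  also have "\<dots> = col B j \<bullet>c col A i"
    using assms by (intro comm_scalar_prod[of _ n]) auto
  finally show ?thesis .
qed

lemma isometry_cols:
  fixes Q :: "complex mat"
  assumes "Q \<in> carrier_mat n m" "mat_adjoint Q * Q = 1\<^sub>m m" "i < m" "j < m"
  shows "col Q j \<bullet>c col Q i = (if i = j then 1 else 0)"
  using mat_adjoint_times_index[OF assms(1,1,3,4)] assms(2-4) by simp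

lemma qr_index:
  assumes "is_qr_decomposition n H Q R" "i < n" "j < n"
  shows "R $$ (i, j) = col H j \<bullet>c col Q i"
proof -
  have c: "H \<in> carrier_mat n n" "Q \<in> carrier_mat n n" "R \<in> carrier_mat n n"
    and Q: "mat_adjoint Q * Q = 1\<^sub>m n" and H: "H = Q * R"
    using assms(1) by (auto simp: is_qr_decomposition_def)
  have "mat_adjoint Q * H = (mat_adjoint Q * Q) * R"
    unfolding H using c mat_adjoint_carrier[OF c(2)] by (simp add: assoc_mult_mat)
  hence "R = mat_adjoint Q * H" using Q c by simp
  thus ?thesis using mat_adjoint_times_index[OF c(2,1) assms(2,3)] by simp
qed

text \<open>If \<open>u i\<close> were nonzero, \<open>col Q i\<close> would be a multiple of it. As
  \<open>col Q i\<close> is orthogonal to the earlier \<open>u k\<close>, its product with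
  \<open>u i\<close> equals that with column \<open>i\<close> of \<open>H\<close>, namely
  \<open>R $$ (i, i) = 0\<close>, contradicting unit length. So \<open>u i\<close> vanishes, and the
  convention makes \<open>col Q i\<close> orthogonal to every column of \<open>H\<close>.\<close>

lemma gram_schmidt_qr_zero_row:
  assumes gs: "is_gram_schmidt_qr n H Q R" and "i < n" "j < n" and zero: "R $$ (i, i) = 0"
  shows "R $$ (i, j) = 0"
proof -
  have qr: "is_qr_decomposition n H Q R"
    using gs by (simp add: is_gram_schmidt_qr_def)
  have H: "H \<in> carrier_mat n n" and Q: "Q \<in> carrier_mat n n" and QQ: "mat_adjoint Q * Q = 1\<^sub>m n"
    using qr by (auto simp: is_qr_decomposition_def)
  define u where "u k = gram_schmidt n (cols H) ! k" for k
  have cols: "set (cols H) \<subseteq> carrier_vec n" "length (cols H) = n"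
    using H by (auto simp: cols_def)
  have uc: "u k \<in> carrier_vec n" if "k < n" for k
    using gram_schmidt_sub2_carrier[of "[]" n "cols H"] cols that
    by (auto simp: u_def gram_schmidt_code)
  have colQ: "col Q k \<in> carrier_vec n" if "k < n" for k
    using Q that by auto
  have nz: "col Q k = complex_of_real (1 / sqrt (Re (u k \<bullet>c u k))) \<cdot>\<^sub>v u k"
    if "k < n" "u k \<noteq> 0\<^sub>v n" for k
    using gs that by (auto simp: is_gram_schmidt_qr_def u_def Let_def)
  have z: "col H l \<bullet>c col Q k = 0" if "k < n" "l < n" "u k = 0\<^sub>v n" for k l
    using gs that by (auto simp: is_gram_schmidt_qr_def u_def Let_def)
  have prod: "col Q k \<bullet>c col Q l = complex_of_real (1 / sqrt (Re (u k \<bullet>c u k))) * (u k \<bullet>c col Q l)"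
    if "k < n" "l < n" "u k \<noteq> 0\<^sub>v n" for k l
    unfolding nz[OF that(1,3)] using uc[OF that(1)] colQ[OF that(2)] Q
    by (intro scalar_prod_smult_left) auto
  have "u i = 0\<^sub>v n"
  proof (rule ccontr)
    assume ui: "u i \<noteq> 0\<^sub>v n"
    have "u k \<bullet>c col Q i = 0" if "k < i" for k
    proof (cases "u k = 0\<^sub>v n")
      case True
      then show ?thesis using colQ[OF \<open>i < n\<close>] by simp
    next
      case False
      have kn: "k < n" using that \<open>i < n\<close> by simp
      \<comment> \<open>A unit vector is nonzero, so the normalizing factor is nonzero and can be
        cancelled.\<close>
      have "col Q k \<noteq> 0\<^sub>v n"
        using isometry_cols[OF Q QQ kn kn] colQ[OF kn] by auto
      hence "1 / sqrt (Re (u k \<bullet>c u k)) \<noteq> 0"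
        using nz[OF kn False] uc[OF kn] by auto
      moreover have "col Q k \<bullet>c col Q i = 0"
        using isometry_cols[OF Q QQ \<open>i < n\<close> kn] that by simp
      ultimately show ?thesis using prod[OF kn \<open>i < n\<close> False] by simp
    qed
    hence "u i \<bullet>c col Q i = cols H ! i \<bullet>c col Q i"
      unfolding u_def using cols colQ \<open>i < n\<close> by (intro gram_schmidt_nth_cscalar_prod) auto
    also have "\<dots> = 0"
      using qr_index[OF qr \<open>i < n\<close> \<open>i < n\<close>] zero H \<open>i < n\<close> by simp
    finally have "col Q i \<bullet>c col Q i = 0" using prod[OF \<open>i < n\<close> \<open>i < n\<close> ui] by simp
    thus False using isometry_cols[OF Q QQ \<open>i < n\<close> \<open>i < n\<close>] by simp
  qed
  thus ?thesis using z[OF \<open>i < n\<close> \<open>j < n\<close>] qr_index[OF qr \<open>i < n\<close> \<open>j < n\<close>] by simp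
qed

text \<open>Entrywise form of \<open>H^* H = R^* Q^* Q R = R^* R\<close>.\<close>

lemma qr_gram:
  assumes qr: "is_qr_decomposition n H Q R" and "i < n" "j < n"
  shows "(\<Sum>k<n. cnj (H $$ (k, i)) * H $$ (k, j)) = (\<Sum>k<n. cnj (R $$ (k, i)) * R $$ (k, j))"
proof -
  have c: "H \<in> carrier_mat n n" "Q \<in> carrier_mat n n" "R \<in> carrier_mat n n"
    and Q: "mat_adjoint Q * Q = 1\<^sub>m n" and H: "H = Q * R"
    using qr by (auto simp: is_qr_decomposition_def)
  have Hk: "H $$ (k, m) = (\<Sum>l<n. Q $$ (k, l) * R $$ (l, m))" if "k < n" "m < n" for k m
    using c that unfolding H by (simp add: scalar_prod_def lessThan_atLeast0)
  have QQ: "(\<Sum>k<n. cnj (Q $$ (k, l)) * Q $$ (k, m)) = (if l = m then 1 else 0)"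
    if "l < n" "m < n" for l m
    using isometry_cols[OF c(2) Q that] c that
    by (simp add: scalar_prod_def lessThan_atLeast0 mult.commute)
  have "(\<Sum>k<n. cnj (H $$ (k, i)) * H $$ (k, j)) =
      (\<Sum>k<n. cnj (H $$ (k, i)) * (\<Sum>m<n. Q $$ (k, m) * R $$ (m, j)))"
    using Hk[OF _ \<open>j < n\<close>] by simp
  also have "\<dots> = (\<Sum>m<n. (\<Sum>k<n. cnj (H $$ (k, i)) * Q $$ (k, m)) * R $$ (m, j))"
    unfolding sum_distrib_left sum_distrib_right by (subst sum.swap) (simp add: mult.assoc)
  also have "\<dots> = (\<Sum>m<n. cnj (R $$ (m, i)) * R $$ (m, j))"
  proof (intro sum.cong refl arg_cong2[where f = "(*)"])
    fix m assume "m \<in> {..<n}"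
    hence m: "m < n" by simp
    have "(\<Sum>k<n. cnj (H $$ (k, i)) * Q $$ (k, m)) =
        (\<Sum>k<n. \<Sum>l<n. cnj (R $$ (l, i)) * (cnj (Q $$ (k, l)) * Q $$ (k, m)))"
      using Hk[OF _ \<open>i < n\<close>] by (simp add: sum_distrib_left mult_ac)
    also have "\<dots> = (\<Sum>l<n. cnj (R $$ (l, i)) * (\<Sum>k<n. cnj (Q $$ (k, l)) * Q $$ (k, m)))"
      unfolding sum_distrib_left by (rule sum.swap)
    also have "\<dots> = (\<Sum>l<n. if l = m then cnj (R $$ (l, i)) else 0)"
      by (intro sum.cong refl) (simp add: QQ m)
    also have "\<dots> = cnj (R $$ (m, i))" using m by simp
    finally show "(\<Sum>k<n. cnj (H $$ (k, i)) * Q $$ (k, m)) = cnj (R $$ (m, i))" .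
  qed
  finally show ?thesis .
qed

text \<open>In the plane, \<open>y\<close> and \<open>b\<close> both annihilate \<open>a\<close>, so
  \<open>y\<close> is a multiple of \<open>b\<close>, which \<open>x\<close> annihilates. The proof
  multiplies by the determinant of \<open>a\<close> and \<open>b\<close>.\<close>

lemma orthogonal_transfer_2:
  fixes a\<^sub>1 a\<^sub>2 b\<^sub>1 b\<^sub>2 x\<^sub>1 x\<^sub>2 y\<^sub>1 y\<^sub>2 :: "'a :: field"
  assumes "a\<^sub>1 * b\<^sub>1 + a\<^sub>2 * b\<^sub>2 = 0" "a\<^sub>1 * y\<^sub>1 + a\<^sub>2 * y\<^sub>2 = 0" "x\<^sub>1 * b\<^sub>1 + x\<^sub>2 * b\<^sub>2 = 0"
    and "a\<^sub>1 * b\<^sub>2 - a\<^sub>2 * b\<^sub>1 \<noteq> 0"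
  shows "x\<^sub>1 * y\<^sub>1 + x\<^sub>2 * y\<^sub>2 = 0"
proof -
  have "(a\<^sub>1 * b\<^sub>2 - a\<^sub>2 * b\<^sub>1) * (x\<^sub>1 * y\<^sub>1 + x\<^sub>2 * y\<^sub>2) =
      (a\<^sub>1 * b\<^sub>1 + a\<^sub>2 * b\<^sub>2) * (x\<^sub>2 * y\<^sub>1 - x\<^sub>1 * y\<^sub>2)
      + (a\<^sub>1 * y\<^sub>1 + a\<^sub>2 * y\<^sub>2) * (x\<^sub>1 * b\<^sub>2 - x\<^sub>2 * b\<^sub>1)
      + (x\<^sub>1 * b\<^sub>1 + x\<^sub>2 * b\<^sub>2) * (a\<^sub>1 * y\<^sub>2 - a\<^sub>2 * y\<^sub>1)"
    by (simp add: algebra_simps)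
  also have "\<dots> = 0" by (simp add: assms(1-3))
  finally show ?thesis using assms(4) by simp
qed

section \<open>The golden code matrix and the real entries of its \<open>R\<close>\<close>

theorem theorem1:
  fixes h :: "nat \<Rightarrow> nat \<Rightarrow> nat \<Rightarrow> complex"
    and \<theta> :: real and c s \<phi> :: complex
    and H Q R :: "complex mat"
  assumes "\<theta> = 1 / 2 * arctan 2"
    and "c = complex_of_real (cos \<theta>)"
    and "s = complex_of_real (sin \<theta>)"
    and "\<phi> = exp (\<i> * complex_of_real pi / 4)"
    and "H = mat_of_rows_list 4
               [[h 1 1 1, 0,       \<phi> * h 2 1 1, 0          ],
                [0,       h 2 1 2, 0,           \<phi> * h 1 1 2],
                [h 1 2 1, 0,       \<phi> * h 2 2 1, 0          ],
                [0,       h 2 2 2, 0,           \<phi> * h 1 2 2]]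
           * mat_of_rows_list 4
               [[ c,  s,  0,  0],
                [-s,  c,  0,  0],
                [ 0,  0,  c,  s],
                [ 0,  0, -s,  c]]"
    and "is_gram_schmidt_qr 4 H Q R"
  shows "\<exists>A B D.
           A \<in> carrier_mat 2 2 \<and> B \<in> carrier_mat 2 2 \<and> D \<in> carrier_mat 2 2 \<and>
           R = four_block_mat A B (0\<^sub>m 2 2) D \<and>
           upper_triangular A \<and> upper_triangular D \<and>
           elements_mat A \<subseteq> \<real> \<and> elements_mat D \<subseteq> \<real>"
proof -
  have lt4: "k < 4 \<longleftrightarrow> k = 0 \<or> k = 1 \<or> k = 2 \<or> k = 3" for k :: nat by auto
  have sum4: "(\<Sum>k<4. f k) = f 0 + f 1 + f 2 + f 3" for f :: "nat \<Rightarrow> complex"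
    by (simp add: numeral_eq_Suc)
  have qr: "is_qr_decomposition 4 H Q R"
    using assms(6) by (simp add: is_gram_schmidt_qr_def)
  have R: "R \<in> carrier_mat 4 4" and tri: "upper_triangular R"
    and diag: "\<And>i. i < 4 \<Longrightarrow> R $$ (i, i) \<in> \<real>"
    using qr by (auto simp: is_qr_decomposition_def)
  define r where "r i j = R $$ (i, j)" for i j
  have lower: "r i j = 0" if "j < i" "i < 4" for i j
    using tri R that by (auto simp: r_def)
  have zero_row: "r i j = 0" if "r i i = 0" "i < 4" "j < 4" for i j
    using gram_schmidt_qr_zero_row[OF assms(6) that(2,3)] that(1) by (simp add: r_def)
  have cs: "cnj c = c" "cnj s = s" "c * c + s * s = 1"
  proof -
    show "cnj c = c" "cnj s = s" using assms(2,3) by simp_all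
    have "c * c + s * s = complex_of_real ((sin \<theta>)\<^sup>2 + (cos \<theta>)\<^sup>2)"
      unfolding assms(2,3) by (simp only: of_real_add of_real_power power2_eq_square of_real_mult add.commute)
    thus "c * c + s * s = 1" by simp
  qed
  \<comment> \<open>Rows 0 and 2 come from \<open>a\<close> and \<open>p\<close>, rows 1 and 3 from
    \<open>b\<close> and \<open>q\<close>, counting from 0.\<close>
  define H' where "H' i j = H $$ (i, j)" for i j
  have H':
    "H' 0 0 = c * h 1 1 1" "H' 0 1 = s * h 1 1 1"
    "H' 0 2 = c * (\<phi> * h 2 1 1)" "H' 0 3 = s * (\<phi> * h 2 1 1)"
    "H' 1 0 = - s * h 2 1 2" "H' 1 1 = c * h 2 1 2"
    "H' 1 2 = - s * (\<phi> * h 1 1 2)" "H' 1 3 = c * (\<phi> * h 1 1 2)"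
    "H' 2 0 = c * h 1 2 1" "H' 2 1 = s * h 1 2 1"
    "H' 2 2 = c * (\<phi> * h 2 2 1)" "H' 2 3 = s * (\<phi> * h 2 2 1)"
    "H' 3 0 = - s * h 2 2 2" "H' 3 1 = c * h 2 2 2"
    "H' 3 2 = - s * (\<phi> * h 1 2 2)" "H' 3 3 = c * (\<phi> * h 1 2 2)"
    unfolding H'_def assms(5)
    by (simp_all add: mat_of_rows_list_def scalar_prod_def numeral_eq_Suc mult.commute)
  define g where "g i j = (\<Sum>k<4. cnj (H' k i) * H' k j)" for i j
  have g: "g i j = cnj (r 0 i) * r 0 j + cnj (r 1 i) * r 1 j + cnj (r 2 i) * r 2 j + cnj (r 3 i) * r 3 j"
    if "i < 4" "j < 4" for i j
    using qr_gram[OF qr that] by (simp add: g_def H'_def r_def sum4)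
  \<comment> \<open>A nonzero real diagonal entry can be divided out; a zero one forces the whole
    row to vanish.\<close>
  have real: "r i j \<in> \<real>" if "cnj (r i i) * r i j \<in> \<real>" "i < 4" "j < 4" for i j
  proof (cases "r i i = 0")
    case False
    have "r i i \<in> \<real>" using diag that by (simp add: r_def)
    thus ?thesis
      by (metis False that(1) Reals_cnj_iff Reals_divide nonzero_mult_div_cancel_left)
  qed (use zero_row that in auto)
  have cnj_diag: "cnj (r i i) = r i i" if "i < 4" for i
    using diag[OF that] by (simp add: r_def Reals_cnj_iff)
  have r01: "r 0 1 \<in> \<real>"
  proof (rule real)
    have "g 0 1 = c * s * (h 1 1 1 * cnj (h 1 1 1) + h 1 2 1 * cnj (h 1 2 1)
        - h 2 1 2 * cnj (h 2 1 2) - h 2 2 2 * cnj (h 2 2 2))"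
      by (simp add: g_def sum4 H'[simplified] cs algebra_simps)
    hence "cnj (g 0 1) = g 0 1" by (simp add: cs mult.commute)
    thus "cnj (r 0 0) * r 0 1 \<in> \<real>" by (simp add: g lower Reals_cnj_iff)
  qed simp_all
  have cnj_r01: "cnj (r 0 1) = r 0 1" using r01 by (simp add: Reals_cnj_iff)

  text \<open>
    The first two coordinates, with respect to the columns of \<open>Q\<close>, of \<open>a\<close>, \<open>b\<close> (real) and
    of \<open>p\<close>, \<open>q\<close>, obtained by undoing the rotation.
  \<close>
  define a0 a1 b0 b1 where "a0 = c * r 0 0 + s * r 0 1" and "a1 = s * r 1 1"
    and "b0 = c * r 0 1 - s * r 0 0" and "b1 = c * r 1 1"
  define x y where "x i = c * r i 2 + s * r i 3" and "y i = c * r i 3 - s * r i 2" for i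
  \<comment> \<open>\<open>Suc 0\<close> is the simplifier's normal form of the index 1.\<close>
  have gs: "cnj (r 0 0) = r 0 0" "cnj (r (Suc 0) (Suc 0)) = r (Suc 0) (Suc 0)" "cnj (r 0 (Suc 0)) = r 0 (Suc 0)"
    using cnj_diag[of 0] cnj_diag[of 1] cnj_r01 by simp_all
  have ab: "a0 * b0 + a1 * b1 = 0"
  proof -
    \<comment> \<open>This is the inner product of \<open>a\<close> and \<open>b\<close>, expanded
      with \<open>a = c h1 + s h2\<close> and \<open>b = c h2 - s h1\<close> for the columns
      \<open>h1\<close>, \<open>h2\<close> of \<open>H\<close>; disjoint supports make it zero. The
      next two facts treat \<open>a\<close>, \<open>q\<close> and \<open>p\<close>, \<open>b\<close>
      alike. Two coordinates suffice, as those of \<open>a\<close> and \<open>b\<close> in rows 2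
      and 3 vanish.\<close>
    have "c * c * g 0 1 - c * s * g 0 0 + s * c * g 1 1 - s * s * g 1 0 = 0"
      by (simp add: g_def sum4 H'[simplified] cs algebra_simps)
    thus ?thesis
      by (simp add: g lower a0_def a1_def b0_def b1_def gs algebra_simps)
  qed
  have ay: "a0 * y 0 + a1 * y 1 = 0"
  proof -
    have "c * c * g 0 3 - c * s * g 0 2 + s * c * g 1 3 - s * s * g 1 2 = 0"
      by (simp add: g_def sum4 H'[simplified] cs algebra_simps)
    thus ?thesis
      by (simp add: g lower a0_def a1_def y_def gs algebra_simps)
  qed
  have xb: "cnj (x 0) * b0 + cnj (x 1) * b1 = 0"
  proof -
    have "c * c * g 2 1 - c * s * g 2 0 + s * c * g 3 1 - s * s * g 3 0 = 0"
      by (simp add: g_def sum4 H'[simplified] cs algebra_simps)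
    thus ?thesis
      by (simp add: g lower x_def b0_def b1_def gs cs algebra_simps)
  qed
  have xy: "cnj (x 0) * y 0 + cnj (x 1) * y 1 = 0"
  proof -
    have row: "x i = 0" "y i = 0" if "r i i = 0" "i < 2" for i
      using zero_row[OF that(1)] that(2) by (simp_all add: x_def y_def)
    \<comment> \<open>A zero diagonal entry removes that coordinate from \<open>x\<close> and
      \<open>y\<close>. If one coordinate remains, \<open>a\<close> or \<open>b\<close> is nonzero
      there, so \<open>y\<close> or \<open>x\<close> is zero there.\<close>
    consider "r 0 0 \<noteq> 0" "r 1 1 \<noteq> 0" | "r 0 0 = 0" "r 1 1 = 0" | "r 0 0 = 0" "r 1 1 \<noteq> 0"
      | "r 0 0 \<noteq> 0" "r 1 1 = 0" by blast
    thus ?thesis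
    proof cases
      case 1
      have "a0 * b1 - a1 * b0 = (c * c + s * s) * (r 0 0 * r 1 1)"
        by (simp add: a0_def a1_def b0_def b1_def algebra_simps)
      hence "a0 * b1 - a1 * b0 \<noteq> 0" using 1 cs(3) by simp
      thus ?thesis using orthogonal_transfer_2[OF ab ay xb] by simp
    next
      case 2
      thus ?thesis using row[of 0] row[of 1] by simp
    next
      case 3
      have "a1 \<noteq> 0 \<or> b1 \<noteq> 0" using 3 cs(3) by (auto simp: a1_def b1_def)
      thus ?thesis using row[of 0] 3 ay xb by auto
    next
      case 4
      have "c * a0 - s * b0 = (c * c + s * s) * r 0 0"
        by (simp add: a0_def b0_def algebra_simps)
      hence "a0 \<noteq> 0 \<or> b0 \<noteq> 0" using 4 cs(3) by auto
      thus ?thesis using row[of 1] 4 ay xb by auto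
    qed
  qed
  have r23: "r 2 3 \<in> \<real>"
  proof (rule real)
    have rot: "r i 2 = c * x i - s * y i" "r i 3 = s * x i + c * y i" for i
    proof -
      have "c * x i - s * y i = (c * c + s * s) * r i 2" "s * x i + c * y i = (c * c + s * s) * r i 3"
        by (simp_all add: x_def y_def algebra_simps)
      thus "r i 2 = c * x i - s * y i" "r i 3 = s * x i + c * y i" using cs(3) by simp_all
    qed
    \<comment> \<open>The inner product of the projected columns 3 and 4; \<open>xy\<close> cancels
      its mixed terms.\<close>
    have "cnj (r 0 2) * r 0 3 + cnj (r 1 2) * r 1 3 =
        c * s * (x 0 * cnj (x 0) + x 1 * cnj (x 1) - y 0 * cnj (y 0) - y 1 * cnj (y 1))
        + c * c * (cnj (x 0) * y 0 + cnj (x 1) * y 1) - s * s * cnj (cnj (x 0) * y 0 + cnj (x 1) * y 1)"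
      by (simp add: rot cs algebra_simps)
    hence p: "cnj (r 0 2) * r 0 3 + cnj (r 1 2) * r 1 3 =
        c * s * (x 0 * cnj (x 0) + x 1 * cnj (x 1) - y 0 * cnj (y 0) - y 1 * cnj (y 1))"
      unfolding xy by simp
    have "cnj (cnj (r 0 2) * r 0 3 + cnj (r 1 2) * r 1 3) = cnj (r 0 2) * r 0 3 + cnj (r 1 2) * r 1 3"
      unfolding p by (simp add: cs algebra_simps)
    hence p': "cnj (r 0 2) * r 0 3 + cnj (r 1 2) * r 1 3 \<in> \<real>" by (simp only: Reals_cnj_iff)
    have "g 2 3 = c * s * (\<phi> * cnj \<phi>) * (h 2 1 1 * cnj (h 2 1 1) + h 2 2 1 * cnj (h 2 2 1)
        - h 1 1 2 * cnj (h 1 1 2) - h 1 2 2 * cnj (h 1 2 2))"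
      by (simp add: g_def sum4 H'[simplified] cs algebra_simps)
    hence "cnj (g 2 3) = g 2 3" by (simp add: cs mult.commute)
    hence "g 2 3 \<in> \<real>" by (simp only: Reals_cnj_iff)
    \<comment> \<open>Row 3 contributes nothing because \<open>r 3 2 = 0\<close>.\<close>
    moreover have "cnj (r 2 2) * r 2 3 = g 2 3 - (cnj (r 0 2) * r 0 3 + cnj (r 1 2) * r 1 3)"
      by (simp add: g lower)
    ultimately show "cnj (r 2 2) * r 2 3 \<in> \<real>" using p' by (simp only: Reals_diff)
  qed simp_all

  define A B D where "A = mat 2 2 (\<lambda>(i, j). r i j)" and "B = mat 2 2 (\<lambda>(i, j). r i (j + 2))"
    and "D = mat 2 2 (\<lambda>(i, j). r (i + 2) (j + 2))"
  have dr: "r i i \<in> \<real>" if "i < 4" for i using diag[OF that] by (simp add: r_def)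
  have rd: "r i j \<in> \<real>" if "(i < 2 \<and> j < 2) \<or> (2 \<le> i \<and> i < 4 \<and> 2 \<le> j \<and> j < 4)" for i j
  proof -
    have "i = j \<or> j < i \<or> (i = 0 \<and> j = 1) \<or> (i = 2 \<and> j = 3)" using that by auto
    thus ?thesis using that dr lower[of j i] r01 r23 by auto
  qed
  have "R = four_block_mat A B (0\<^sub>m 2 2) D"
  proof (rule eq_matI)
    fix i j assume "i < dim_row (four_block_mat A B (0\<^sub>m 2 2) D)" "j < dim_col (four_block_mat A B (0\<^sub>m 2 2) D)"
    hence ij: "i < 4" "j < 4" by (simp_all add: A_def D_def)
    show "R $$ (i, j) = four_block_mat A B (0\<^sub>m 2 2) D $$ (i, j)"
      using ij lower[of j i] by (auto simp: A_def B_def D_def r_def lt4 numeral_2_eq_2 numeral_3_eq_3)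
  qed (use R in \<open>auto simp: A_def D_def\<close>)
  moreover have "upper_triangular A" "upper_triangular D"
    using lower by (auto simp: A_def D_def)
  moreover have "elements_mat A \<subseteq> \<real>" "elements_mat D \<subseteq> \<real>"
    by (auto simp: A_def D_def elements_mat_def intro!: rd)
  ultimately show ?thesis
    by (intro exI[of _ A] exI[of _ B] exI[of _ D]) (simp add: A_def B_def D_def)
qed

end
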